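(* Let $a$ and $b$ be positive integers. If $a,b\geq 2$ and $a+b\geq 12$, then $$\mathrm{pp}(a)\,\mathrm{pp}(b) > \mathrm{pp}(a+b).$$ Moreover, the equality $\mathrm{pp}(a)\,\mathrm{pp}(b)=\mathrm{pp}(a+b)$ never holds for positive integers $a,b$.
   Context: A plane partition of a non-negative integer $n$ is an array $\pi=(\pi_{ij})_{i,j\geq 1}$ of non-negative integers with $\sum_{i,j\ge 1}\pi_{ij}=n$ that is weakly decreasing along rows and columns. $\mathrm{pp}(n)$ denotes the number of plane partitions of $n$, with $\mathrm{pp}(0)=1$. By MacMahon's theorem, $\sum_{n\ge 0}\mathrm{pp}(n)q^n=\prod_{n\ge1}(1-q^n)^{-n}$; equivalently $n\,\mathrm{pp}(n)=\sum_{k=1}^n\sigma_2(k)\,\mathrm{pp}(n-k)$ for $n\ge 1$, where $\sigma_2(k)=\sum_{d\mid k}d^2$. *)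

theory Defs
  imports Complex_Main
begin

text \<open>
  Rows and columns are indexed from 0 rather than from 1. A family of natural numbers has a finite
  sum exactly when its support is finite, and the sum is then the sum over the support.
\<close>

definition plane_partition_of :: "nat \<Rightarrow> (nat \<Rightarrow> nat \<Rightarrow> nat) \<Rightarrow> bool" where
  "plane_partition_of n \<pi> \<longleftrightarrow>
     (\<forall>i j. \<pi> i (Suc j) \<le> \<pi> i j) \<and>
     (\<forall>i j. \<pi> (Suc i) j \<le> \<pi> i j) \<and>
     finite {(i, j). \<pi> i j \<noteq> 0} \<and>
     (\<Sum>(i, j) | \<pi> i j \<noteq> 0. \<pi> i j) = n"

definition pp :: "nat \<Rightarrow> nat" where
  "pp n = card {\<pi>. plane_partition_of n \<pi>}"

text \<open>The cardinality in \<^const>\<open>pp\<close> is that of a finite set, so it is a genuine count.\<close>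

lemma finite_plane_partitions: "finite {\<pi>. plane_partition_of n \<pi>}"
proof -
  let ?F = "{f :: nat \<times> nat \<Rightarrow> nat. \<forall>x. (x \<in> {..n} \<times> {..n} \<longrightarrow> f x \<in> {..n}) \<and>
              (x \<notin> {..n} \<times> {..n} \<longrightarrow> f x = 0)}"
  have fin: "finite ?F"
    by (rule finite_set_of_finite_funs) auto
  have "case_prod \<pi> \<in> ?F" if p: "plane_partition_of n \<pi>" for \<pi>
  proof -
    let ?S = "{(i, j). \<pi> i j \<noteq> 0}"
    from p have row: "\<pi> i (Suc j) \<le> \<pi> i j" and col: "\<pi> (Suc i) j \<le> \<pi> i j"
      and fS: "finite ?S" and sm: "sum (case_prod \<pi>) ?S = n" for i j
      by (auto simp: plane_partition_of_def)
    have le: "\<pi> i j \<le> n" for i j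
    proof (cases "\<pi> i j = 0")
      case False
      then show ?thesis using member_le_sum[of "(i, j)" ?S "case_prod \<pi>"] fS sm by auto
    qed simp
    have cS: "card ?S \<le> n"
      using sum_mono[of ?S "\<lambda>_. 1" "case_prod \<pi>"] sm by (auto simp: Suc_le_eq)
    have bound: "i < n \<and> j < n" if nz: "\<pi> i j \<noteq> 0" for i j
    proof -
      have "\<pi> i j \<le> \<pi> i' j" if "i' \<le> i" for i'
        using that by (rule lift_Suc_antimono_le[of "\<lambda>i. \<pi> i j", OF col])
      with nz have "(\<lambda>i. (i, j)) ` {..i} \<subseteq> ?S" by fastforce
      from card_mono[OF fS this] have 1: "Suc i \<le> card ?S"
        by (simp add: card_image inj_on_def)
      have "\<pi> i j \<le> \<pi> i j'" if "j' \<le> j" for j'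
        using that by (rule lift_Suc_antimono_le[of "\<lambda>j. \<pi> i j", OF row])
      with nz have "(\<lambda>j. (i, j)) ` {..j} \<subseteq> ?S" by fastforce
      from card_mono[OF fS this] have "Suc j \<le> card ?S"
        by (simp add: card_image inj_on_def)
      with 1 cS show ?thesis by auto
    qed
    have zero: "\<pi> i j = 0" if "\<not> i \<le> n \<or> \<not> j \<le> n" for i j
      using bound[of i j] that by linarith
    show ?thesis by (simp add: le zero split: prod.split)
  qed
  then have "case_prod ` {\<pi>. plane_partition_of n \<pi>} \<subseteq> ?F"
    by (intro image_subsetI) (simp only: mem_Collect_eq)
  then have "finite (case_prod ` {\<pi>. plane_partition_of n \<pi>})"
    using fin by (rule finite_subset)
  moreover have "inj_on case_prod {\<pi>. plane_partition_of n \<pi>}"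
    by (rule inj_on_inverseI[where g = curry]) (rule curry_case_prod)
  ultimately show ?thesis by (rule finite_imageD)
qed

lemma pp_0: "pp 0 = 1"
proof -
  have "{\<pi>. plane_partition_of 0 \<pi>} = {\<lambda>_ _. 0}"
    by (auto simp: plane_partition_of_def fun_eq_iff)
  then show ?thesis by (simp add: pp_def)
qed

end

theory Submission
  imports Defs "HOL-Analysis.Analysis"
begin

text \<open>
  Cut along its diagonals, a plane partition becomes a sequence of pairwise interlacing partitions.
  A local reflection exchanges an interlacing step up with a step down at the cost of one free
  natural number; sorting all the steps gives MacMahon's product formula for plane partitions in an
  \<open>N \<times> N\<close> box, as an identity of extended non-negative reals at every weight \<open>q\<close>. Comparing power series
  and taking the logarithmic derivative yields \<open>n * pp n = (\<Sum>k=1..n. \<sigma>\<^sub>2 k * pp (n - k))\<close>.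

  For the inequality, let \<open>a \<ge> b\<close> and argue by induction on \<open>a + b\<close>. Expand \<open>(a + b) * pp (a + b)\<close> by
  the recurrence. The summands with \<open>k \<le> a\<close> are at most \<open>a * pp a * pp b\<close> by the induction hypothesis,
  up to a few exceptions. As \<open>\<sigma>\<^sub>2 (a + k) \<le> 8 a\<^sup>3 \<sigma>\<^sub>2 k\<close> for \<open>k \<le> b\<close>, the other summands are at most
  \<open>8 a\<^sup>3 b * pp b\<close>. Since \<open>pp a\<close> outgrows \<open>a\<^sup>3\<close>, both errors fit into the remaining \<open>b * pp a * pp b\<close>
  once \<open>a \<ge> 34\<close>; smaller \<open>a\<close> are checked on a table.
\<close>

section \<open>Interlacing sequences and local moves\<close>

text \<open>Extended non-negative sums always exist and may be interchanged freely, so summability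
  questions are postponed until the final product is evaluated.\<close>

abbreviation nsum :: "('a \<Rightarrow> ennreal) \<Rightarrow> ennreal"  (binder "\<Sum>\<^sup>+" 10)
  where "nsum f \<equiv> integral\<^sup>N (count_space UNIV) f"

lemma nsum_swap: "(\<Sum>\<^sup>+ x. \<Sum>\<^sup>+ y. f x y) = (\<Sum>\<^sup>+ y. \<Sum>\<^sup>+ x. f x y)"
  using nn_integral_fst_count_space[of "case_prod f"] nn_integral_snd_count_space[of "case_prod f"]
  by simp

lemma nsum_of_bool: "(\<Sum>\<^sup>+ x. of_bool (P x) * f x) = (\<integral>\<^sup>+ x. f x \<partial>count_space {x. P x})"
  by (subst (2) nn_integral_count_space_indicator) (auto intro!: nn_integral_cong split: split_indicator)

lemma nsum_bij:
  assumes "bij_betw g {x. P x} {y. Q y}"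
  shows "(\<Sum>\<^sup>+ x. of_bool (P x) * f (g x)) = (\<Sum>\<^sup>+ y. of_bool (Q y) * f y)"
  unfolding nsum_of_bool by (rule nn_integral_bij_count_space[OF assms])

lemma nsum_single: "(\<Sum>\<^sup>+ x. of_bool (x = a) * f x) = f a"
  unfolding nsum_of_bool by (simp add: nn_integral_count_space_finite)

lemma nsum_times: "(\<Sum>\<^sup>+ x. f x) * (\<Sum>\<^sup>+ y. g y) = (\<Sum>\<^sup>+ p. f (fst p) * g (snd p))"
  by (subst nn_integral_fst_count_space[symmetric]) (simp add: nn_integral_cmult nn_integral_multc)

text \<open>The chain \<open>l 0 \<ge> k 0 \<ge> l 1 \<ge> k 1 \<ge> ...\<close> makes both
  sequences weakly decreasing: \<open>l / k\<close> is a horizontal strip.\<close>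

definition interlaces :: "(nat \<Rightarrow> nat) \<Rightarrow> (nat \<Rightarrow> nat) \<Rightarrow> bool" where
  "interlaces k l \<longleftrightarrow> (\<forall>i. k i \<le> l i \<and> l (Suc i) \<le> k i)"

definition fin_supp :: "(nat \<Rightarrow> nat) \<Rightarrow> bool" where
  "fin_supp l \<longleftrightarrow> (\<exists>M. \<forall>i\<ge>M. l i = 0)"

text \<open>An infinite support yields the default value 0, so statements about sizes come with
  \<open>fin_supp\<close>.\<close>

definition psize :: "(nat \<Rightarrow> nat) \<Rightarrow> nat" where
  "psize l = (\<Sum>i | l i \<noteq> 0. l i)"

lemma psize_eq: "(\<And>i. i \<ge> M \<Longrightarrow> l i = 0) \<Longrightarrow> psize l = (\<Sum>i<M. l i)"
  unfolding psize_def by (rule sum.mono_neutral_left) (use not_less in auto)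

lemma psize_zero [simp]: "psize (\<lambda>_. 0) = 0"
  by (simp add: psize_def)

lemma fin_supp_interlaces:
  assumes "interlaces k l" shows "fin_supp k \<longleftrightarrow> fin_supp l"
proof
  assume "fin_supp k"
  then obtain M where M: "\<forall>i\<ge>M. k i = 0" by (auto simp: fin_supp_def)
  have "l i = 0" if "i \<ge> Suc M" for i
  proof -
    from that obtain j where "i = Suc j" "j \<ge> M" by (metis Suc_le_D Suc_le_mono)
    then show ?thesis using assms M by (metis interlaces_def le_zero_eq)
  qed
  then show "fin_supp l" by (auto simp: fin_supp_def)
next
  assume "fin_supp l"
  then show "fin_supp k" using assms unfolding fin_supp_def interlaces_def by (metis le_zero_eq)
qed

lemma psize_mono:
  assumes "interlaces k l" "fin_supp l" shows "psize k \<le> psize l"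
proof -
  obtain M where M: "\<And>i. i\<ge>M \<Longrightarrow> l i = 0" using assms by (auto simp: fin_supp_def)
  moreover have "\<And>i. i\<ge>M \<Longrightarrow> k i = 0" using assms M by (metis interlaces_def le_zero_eq)
  ultimately show ?thesis using assms by (auto simp: psize_eq[of M] interlaces_def intro!: sum_mono)
qed

text \<open>
  If \<open>k\<close> interlaces both \<open>l\<close> and \<open>m\<close>, then its entry \<open>k j\<close> ranges over an interval, and so does
  the entry \<open>Suc j\<close> of a sequence interlaced by both, over the same interval. Reflecting each of these
  intervals leaves only the first entry unaccounted for; its excess over the minimum is \<open>c\<close>.
\<close>

definition toggle :: "(nat \<Rightarrow> nat) \<Rightarrow> (nat \<Rightarrow> nat) \<Rightarrow> nat \<times> (nat \<Rightarrow> nat) \<Rightarrow> nat \<Rightarrow> nat" where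
  "toggle l m = (\<lambda>(c, k) i. case i of 0 \<Rightarrow> max (l 0) (m 0) + c
      | Suc j \<Rightarrow> min (l j) (m j) + max (l (Suc j)) (m (Suc j)) - k j)"

lemma bij_betw_toggle:
  "bij_betw (toggle l m) {p. interlaces (snd p) m \<and> interlaces (snd p) l}
     {n. interlaces m n \<and> interlaces l n}"
proof (rule bij_betw_byWitness[where f' = "\<lambda>n. (n 0 - max (l 0) (m 0),
          \<lambda>j. min (l j) (m j) + max (l (Suc j)) (m (Suc j)) - n (Suc j))"], goal_cases)
  case 1
  have "k j \<le> min (l j) (m j) + max (l (Suc j)) (m (Suc j))" if "interlaces k m" "interlaces k l" for k j
    using that by (simp add: interlaces_def trans_le_add1)
  then show ?case by (simp add: toggle_def)
next
  case 2
  have "toggle l m (n 0 - max (l 0) (m 0), \<lambda>j. min (l j) (m j) + max (l (Suc j)) (m (Suc j)) - n (Suc j)) i = n i"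
    if "interlaces m n" "interlaces l n" for n i
    using that[unfolded interlaces_def, THEN spec, of i] that[unfolded interlaces_def, THEN spec, of "i - 1"]
    by (cases i) (auto simp: toggle_def)
  then show ?case by auto
next
  case 3
  have "m i \<le> toggle l m (c, k) i \<and> toggle l m (c, k) (Suc i) \<le> m i \<and> l i \<le> toggle l m (c, k) i \<and> toggle l m (c, k) (Suc i) \<le> l i"
    if "interlaces k m" "interlaces k l" for c k i
    using that[unfolded interlaces_def, THEN spec, of i] that[unfolded interlaces_def, THEN spec, of "i - 1"]
    by (cases i) (auto simp: toggle_def)
  then show ?case by (auto simp: interlaces_def)
next
  case 4
  have "min (l j) (m j) + max (l (Suc j)) (m (Suc j)) - n (Suc j) \<le> m j \<and> 
      m (Suc j) \<le> min (l j) (m j) + max (l (Suc j)) (m (Suc j)) - n (Suc j) \<and> 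
      min (l j) (m j) + max (l (Suc j)) (m (Suc j)) - n (Suc j) \<le> l j \<and>
      l (Suc j) \<le> min (l j) (m j) + max (l (Suc j)) (m (Suc j)) - n (Suc j)"
    if "interlaces m n" "interlaces l n" for n j
    using that[unfolded interlaces_def, THEN spec, of j] that[unfolded interlaces_def, THEN spec, of "Suc j"]
    by auto
  then show ?case by (auto simp: interlaces_def)
qed

text \<open>Each reflected entry together with \<open>k j\<close> adds up to a minimum at
  \<open>j\<close> and a maximum at \<open>Suc j\<close>. The entry at 0 supplies the one missing
  maximum, and \<open>min + max\<close> is the sum of both entries.\<close>

lemma psize_toggle:
  assumes "interlaces k m" "interlaces k l" "fin_supp k"
  shows "psize (toggle l m (c, k)) + psize k = c + psize l + psize m"
proof -
  obtain M1 M2 where M: "\<And>i. i \<ge> M1 \<Longrightarrow> l i = 0" "\<And>i. i \<ge> M2 \<Longrightarrow> m i = 0"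
    using assms fin_supp_interlaces unfolding fin_supp_def by metis
  define M where "M = max M1 M2"
  have l: "l i = 0" and m: "m i = 0" if "i \<ge> M" for i
    using M that by (auto simp: M_def)
  have km: "k i \<le> m i" and kl: "k i \<le> l i" for i using assms by (auto simp: interlaces_def)
  then have k: "k i = 0" if "i \<ge> M" for i using m that by (metis le_zero_eq)
  have t: "toggle l m (c, k) i = 0" if "i \<ge> Suc M" for i
    using that l m by (cases i) (auto simp: toggle_def)
  have "psize (toggle l m (c, k)) + psize k =
        toggle l m (c, k) 0 + (\<Sum>i<M. toggle l m (c, k) (Suc i) + k i)"
    by (simp only: psize_eq[OF t] psize_eq[OF k] sum.lessThan_Suc_shift sum.distrib add.assoc)
  also have "(\<Sum>i<M. toggle l m (c, k) (Suc i) + k i) = (\<Sum>i<M. min (l i) (m i) + max (l (Suc i)) (m (Suc i)))"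
    using km kl by (intro sum.cong) (auto simp: toggle_def trans_le_add1)
  also have "toggle l m (c, k) 0 = max (l 0) (m 0) + c"
    by (simp add: toggle_def)
  also have "max (l 0) (m 0) + c + (\<Sum>i<M. min (l i) (m i) + max (l (Suc i)) (m (Suc i)))
     = c + (\<Sum>i<M. min (l i) (m i)) + (\<Sum>i<Suc M. max (l i) (m i))"
    by (simp only: sum.lessThan_Suc_shift sum.distrib add_ac)
  also have "\<dots> = c + (\<Sum>i<M. min (l i) (m i) + max (l i) (m i))"
    by (simp add: sum.distrib l m)
  also have "(\<Sum>i<M. min (l i) (m i) + max (l i) (m i)) = (\<Sum>i<M. l i) + (\<Sum>i<M. m i)"
    by (subst sum.distrib[symmetric], rule sum.cong) auto
  also have "\<dots> = psize l + psize m" by (simp add: psize_eq[OF l] psize_eq[OF m])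
  finally show ?thesis by simp
qed

definition geo :: "ennreal \<Rightarrow> ennreal" where
  "geo y = (\<Sum>\<^sup>+ n::nat. y ^ n)"

text \<open>This is the commutation relation of an up-step with a down-step. The free number
  \<open>c\<close> of \<open>toggle\<close> contributes the factor \<open>geo y\<close>.\<close>

lemma toggle_sum:
  assumes "fin_supp l"
  shows "(\<Sum>\<^sup>+ n. of_bool (interlaces m n \<and> interlaces l n) * y ^ (psize n - psize m))
       = geo y * (\<Sum>\<^sup>+ k. of_bool (interlaces k m \<and> interlaces k l) * y ^ (psize l - psize k))"
proof -
  have "(\<Sum>\<^sup>+ n. of_bool (interlaces m n \<and> interlaces l n) * y ^ (psize n - psize m))
     = (\<Sum>\<^sup>+ p. of_bool (interlaces (snd p) m \<and> interlaces (snd p) l) * y ^ (psize (toggle l m p) - psize m))"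
    by (rule nsum_bij[symmetric]) (rule bij_betw_toggle)
  also have "\<dots> = (\<Sum>\<^sup>+ p. y ^ fst p * (of_bool (interlaces (snd p) m \<and> interlaces (snd p) l) * y ^ (psize l - psize (snd p))))"
  proof (rule nn_integral_cong, clarsimp)
    fix c k assume k: "interlaces k m" "interlaces k l"
    then have "fin_supp k" using assms fin_supp_interlaces by blast
    with k psize_toggle[of k m l c] psize_mono[of k l] assms
    have "psize (toggle l m (c, k)) - psize m = c + (psize l - psize k)" by linarith
    then show "y ^ (psize (toggle l m (c, k)) - psize m) = y ^ c * y ^ (psize l - psize k)"
      by (simp add: power_add)
  qed
  also have "\<dots> = geo y * (\<Sum>\<^sup>+ k. of_bool (interlaces k m \<and> interlaces k l) * y ^ (psize l - psize k))"
    unfolding geo_def by (subst nsum_times) simp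
  finally show ?thesis .
qed

text \<open>
  For a partition \<open>l\<close> this is the Schur polynomial of \<open>l\<close> at \<open>(1, q, \<dots>, q ^ (r - 1))\<close>. The next two
  lemmas are then the Pieri and Cauchy identities.
\<close>

primrec chain_sum :: "ennreal \<Rightarrow> nat \<Rightarrow> (nat \<Rightarrow> nat) \<Rightarrow> ennreal" where
  "chain_sum q 0 l = of_bool (l = (\<lambda>_. 0))"
| "chain_sum q (Suc r) l = (\<Sum>\<^sup>+ k. of_bool (interlaces k l) * (q ^ psize k * chain_sum q r k))"

text \<open>Chains end in the zero sequence and interlacing preserves finite support. Sums may
  therefore run over all sequences while size identities are used only for finite support.\<close>

lemma chain_sum_eq_0: "\<not> fin_supp l \<Longrightarrow> chain_sum q r l = 0"
proof (induction r arbitrary: l)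
  case 0
  then show ?case by (auto simp: fin_supp_def)
next
  case (Suc r)
  have "of_bool (interlaces k l) * (q ^ psize k * chain_sum q r k) = 0" for k
    using Suc fin_supp_interlaces[of k l] by (cases "interlaces k l") auto
  then show ?case by (simp only: chain_sum.simps) simp
qed

lemma chain_sum_up:
  "(\<Sum>\<^sup>+ l. of_bool (interlaces m l) * (y ^ (psize l - psize m) * chain_sum q r l))
     = (\<Prod>i<r. geo (y * q ^ i)) * chain_sum q r m"
proof (induction r arbitrary: m y)
  case 0
  have "(\<Sum>\<^sup>+ l. of_bool (interlaces m l) * (y ^ (psize l - psize m) * chain_sum q 0 l))
     = (\<Sum>\<^sup>+ l. of_bool (l = (\<lambda>_. 0)) * (of_bool (interlaces m l) * y ^ (psize l - psize m)))"
    by (rule nn_integral_cong) (auto simp: mult_ac)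
  also have "\<dots> = of_bool (m = (\<lambda>_. 0))"
    by (subst nsum_single) (auto simp: interlaces_def)
  finally show ?case by simp
next
  case (Suc r)
  show ?case
  proof -
    \<comment> \<open>The last chain step \<open>l\<close> below \<open>n\<close> is toggled against
      \<open>m\<close> below \<open>n\<close>, replacing \<open>n\<close> by some \<open>k\<close>
      below both. The remaining sum over \<open>l\<close> above \<open>k\<close> has the same form
      with \<open>y * q\<close> for \<open>y\<close>, because \<open>q ^ psize l\<close> also grows
      with \<open>l\<close>.\<close>
    let ?f = "\<lambda>l. q ^ psize l * chain_sum q r l"
    have "(\<Sum>\<^sup>+ n. of_bool (interlaces m n) * (y ^ (psize n - psize m) * chain_sum q (Suc r) n))
      = (\<Sum>\<^sup>+ n. \<Sum>\<^sup>+ l. ?f l * (of_bool (interlaces m n \<and> interlaces l n) * y ^ (psize n - psize m)))"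
      by (simp add: nn_integral_cmult[symmetric] of_bool_conj mult_ac)
    also have "\<dots> = (\<Sum>\<^sup>+ l. ?f l * (\<Sum>\<^sup>+ n. of_bool (interlaces m n \<and> interlaces l n) * y ^ (psize n - psize m)))"
      by (subst nsum_swap) (simp add: nn_integral_cmult)
    also have "\<dots> = (\<Sum>\<^sup>+ l. geo y * (?f l * (\<Sum>\<^sup>+ k. of_bool (interlaces k m \<and> interlaces k l) * y ^ (psize l - psize k))))"
    proof (rule nn_integral_cong)
      fix l
      show "?f l * (\<Sum>\<^sup>+ n. of_bool (interlaces m n \<and> interlaces l n) * y ^ (psize n - psize m)) =
          geo y * (?f l * (\<Sum>\<^sup>+ k. of_bool (interlaces k m \<and> interlaces k l) * y ^ (psize l - psize k)))"
        by (cases "fin_supp l") (simp_all add: toggle_sum chain_sum_eq_0 mult.left_commute)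
    qed
    also have "\<dots> = geo y * (\<Sum>\<^sup>+ l. \<Sum>\<^sup>+ k. ?f l * (of_bool (interlaces k m \<and> interlaces k l) * y ^ (psize l - psize k)))"
      by (simp add: nn_integral_cmult)
    also have "(\<Sum>\<^sup>+ l. \<Sum>\<^sup>+ k. ?f l * (of_bool (interlaces k m \<and> interlaces k l) * y ^ (psize l - psize k)))
      = (\<Sum>\<^sup>+ k. of_bool (interlaces k m) * (\<Sum>\<^sup>+ l. of_bool (interlaces k l) * (y ^ (psize l - psize k) * ?f l)))"
      by (subst nsum_swap) (simp add: nn_integral_cmult[symmetric] of_bool_conj mult_ac)
    also have "\<dots> = (\<Sum>\<^sup>+ k. of_bool (interlaces k m) * (q ^ psize k * (\<Sum>\<^sup>+ l. of_bool (interlaces k l) * ((y * q) ^ (psize l - psize k) * chain_sum q r l))))"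
    proof (rule nn_integral_cong)
      fix k
      have "of_bool (interlaces k l) * (y ^ (psize l - psize k) * ?f l)
        = q ^ psize k * (of_bool (interlaces k l) * ((y * q) ^ (psize l - psize k) * chain_sum q r l))" for l
      proof (cases "interlaces k l \<and> fin_supp l")
        case True
        then have "q ^ psize l = q ^ psize k * q ^ (psize l - psize k)"
          using psize_mono[of k l] by (simp add: power_add[symmetric])
        then show ?thesis by (simp add: power_mult_distrib mult_ac)
      qed (auto simp: chain_sum_eq_0)
      then show "of_bool (interlaces k m) * (\<Sum>\<^sup>+ l. of_bool (interlaces k l) * (y ^ (psize l - psize k) * ?f l)) = of_bool (interlaces k m) * (q ^ psize k * (\<Sum>\<^sup>+ l. of_bool (interlaces k l) * ((y * q) ^ (psize l - psize k) * chain_sum q r l)))"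
        by (simp add: nn_integral_cmult)
    qed
    also have "\<dots> = (\<Prod>i<r. geo (y * q * q ^ i)) * chain_sum q (Suc r) m"
      unfolding Suc.IH by (simp add: nn_integral_cmult[symmetric] mult_ac)
    also have "geo y * ((\<Prod>i<r. geo (y * q * q ^ i)) * chain_sum q (Suc r) m) = (\<Prod>i<Suc r. geo (y * q ^ i)) * chain_sum q (Suc r) m"
      by (simp only: prod.lessThan_Suc_shift) (simp add: mult_ac)
    finally show ?thesis .
  qed
qed

lemma box_sum:
  "(\<Sum>\<^sup>+ l. z ^ psize l * (chain_sum q r l * chain_sum q c l)) = (\<Prod>j<c. \<Prod>i<r. geo (z * q ^ (i + j)))"
proof (induction c arbitrary: z)
  case 0
  have "chain_sum q r (\<lambda>_. 0) = 1" for r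
  proof (induction r)
    case (Suc r)
    have "interlaces k (\<lambda>_. 0) \<longleftrightarrow> k = (\<lambda>_. 0)" for k
      by (auto simp: interlaces_def)
    then show ?case by (simp add: nsum_single Suc)
  qed simp
  then show ?case using nsum_single[of "\<lambda>_. 0" "\<lambda>l. z ^ psize l * chain_sum q r l"] by (simp add: mult_ac)
next
  case (Suc c)
  \<comment> \<open>Peeling one step \<open>k\<close> off the second chain leaves a sum over
    \<open>l\<close> above \<open>k\<close>, which \<open>chain_sum_up\<close> evaluates; the weight
    left on \<open>k\<close> is \<open>z * q\<close>.\<close>
  have "(\<Sum>\<^sup>+ l. z ^ psize l * (chain_sum q r l * chain_sum q (Suc c) l))
    = (\<Sum>\<^sup>+ k. q ^ psize k * (chain_sum q c k * (\<Sum>\<^sup>+ l. of_bool (interlaces k l) * (z ^ psize l * chain_sum q r l))))"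
    by (simp add: nn_integral_cmult[symmetric], subst nsum_swap) (simp add: mult_ac)
  also have "\<dots> = (\<Sum>\<^sup>+ k. (\<Prod>i<r. geo (z * q ^ i)) * ((z * q) ^ psize k * (chain_sum q r k * chain_sum q c k)))"
  proof (rule nn_integral_cong)
    fix k
    have "of_bool (interlaces k l) * (z ^ psize l * chain_sum q r l)
        = z ^ psize k * (of_bool (interlaces k l) * (z ^ (psize l - psize k) * chain_sum q r l))" for l
    proof (cases "interlaces k l \<and> fin_supp l")
      case True
      then have "z ^ psize l = z ^ psize k * z ^ (psize l - psize k)"
        using psize_mono[of k l] by (simp add: power_add[symmetric])
      then show ?thesis by (simp add: mult_ac)
    qed (auto simp: chain_sum_eq_0)
    then have "(\<Sum>\<^sup>+ l. of_bool (interlaces k l) * (z ^ psize l * chain_sum q r l)) =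
       z ^ psize k * ((\<Prod>i<r. geo (z * q ^ i)) * chain_sum q r k)"
      by (simp add: nn_integral_cmult chain_sum_up)
    then show "q ^ psize k * (chain_sum q c k * (\<Sum>\<^sup>+ l. of_bool (interlaces k l) * (z ^ psize l * chain_sum q r l)))
       = (\<Prod>i<r. geo (z * q ^ i)) * ((z * q) ^ psize k * (chain_sum q r k * chain_sum q c k))"
      by (simp add: mult_ac power_mult_distrib)
  qed
  also have "\<dots> = (\<Prod>i<r. geo (z * q ^ i)) * (\<Prod>j<c. \<Prod>i<r. geo (z * q * q ^ (i + j)))"
    by (simp add: nn_integral_cmult Suc.IH)
  also have "\<dots> = (\<Prod>j<Suc c. \<Prod>i<r. geo (z * q ^ (i + j)))"
    by (simp only: prod.lessThan_Suc_shift) (simp add: mult_ac)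
  finally show ?case .
qed


section \<open>Plane partitions in a box\<close>

definition is_chain :: "nat \<Rightarrow> (nat \<Rightarrow> nat \<Rightarrow> nat) \<Rightarrow> bool" where
  "is_chain r t \<longleftrightarrow> (\<forall>c. interlaces (t (Suc c)) (t c)) \<and> (\<forall>c\<ge>r. t c = (\<lambda>_. 0))"

text \<open>The member \<open>t 0\<close> is left out because the main diagonal is shared by two
  chains and must be counted once.\<close>

definition tail_size :: "nat \<Rightarrow> (nat \<Rightarrow> nat \<Rightarrow> nat) \<Rightarrow> nat" where
  "tail_size r t = (\<Sum>c<r. psize (t (Suc c)))"

lemma chain_sum_chains:
  "chain_sum q r l = (\<Sum>\<^sup>+ t. of_bool (is_chain r t \<and> t 0 = l) * q ^ tail_size r t)"
proof (induction r arbitrary: l)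
  case 0
  have *: "is_chain 0 t \<and> t 0 = l \<longleftrightarrow> t = (\<lambda>_ _. 0) \<and> l = (\<lambda>_. 0)" for t
    by (auto simp: is_chain_def interlaces_def fun_eq_iff)
  show ?case
    unfolding * of_bool_conj mult.assoc by (subst nsum_single) (simp add: tail_size_def)
next
  case (Suc r)
  \<comment> \<open>\<open>?g\<close> prepends \<open>l\<close> to a chain. The next member
    \<open>k\<close> is determined as \<open>t 0\<close>, so the sum over it collapses.\<close>
  let ?g = "\<lambda>t c. case c of 0 \<Rightarrow> l | Suc c \<Rightarrow> t c"
  have "chain_sum q (Suc r) l = (\<Sum>\<^sup>+ t. \<Sum>\<^sup>+ k. of_bool (k = t 0) *
      (of_bool (is_chain r t \<and> interlaces k l) * (q ^ psize k * q ^ tail_size r t)))"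
    by (simp add: Suc.IH nn_integral_cmult[symmetric], subst nsum_swap)
       (auto intro!: nn_integral_cong simp: mult_ac)
  also have "\<dots> = (\<Sum>\<^sup>+ t. of_bool (is_chain r t \<and> interlaces (t 0) l) * q ^ tail_size (Suc r) (?g t))"
    by (simp only: nsum_single) (simp add: tail_size_def power_add sum.lessThan_Suc_shift del: sum.lessThan_Suc)
  also have "\<dots> = (\<Sum>\<^sup>+ t. of_bool (is_chain (Suc r) t \<and> t 0 = l) * q ^ tail_size (Suc r) t)"
  proof (rule nsum_bij, rule bij_betw_byWitness[where f' = "\<lambda>t c. t (Suc c)"], goal_cases)
    case 2
    then show ?case by (auto simp: fun_eq_iff split: nat.splits)
  next
    case 3
    then show ?case by (auto simp: is_chain_def split: nat.splits)
  next
    case 4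
    then show ?case by (auto simp: is_chain_def)
  qed simp
  finally show ?case .
qed

definition box_partition :: "nat \<Rightarrow> (nat \<Rightarrow> nat \<Rightarrow> nat) \<Rightarrow> bool" where
  "box_partition N \<pi> \<longleftrightarrow>
     (\<forall>i j. \<pi> i (Suc j) \<le> \<pi> i j) \<and> (\<forall>i j. \<pi> (Suc i) j \<le> \<pi> i j) \<and>
     (\<forall>i j. N \<le> i \<or> N \<le> j \<longrightarrow> \<pi> i j = 0)"

definition box_size :: "nat \<Rightarrow> (nat \<Rightarrow> nat \<Rightarrow> nat) \<Rightarrow> nat" where
  "box_size N \<pi> = (\<Sum>i<N. \<Sum>j<N. \<pi> i j)"

text \<open>
  The diagonals of a plane partition on and above the main one, read from the centre outwards, form
  a chain, and so do the diagonals on and below it.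
\<close>

definition glue :: "(nat \<Rightarrow> nat \<Rightarrow> nat) \<times> (nat \<Rightarrow> nat \<Rightarrow> nat) \<Rightarrow> nat \<Rightarrow> nat \<Rightarrow> nat" where
  "glue = (\<lambda>(t, s) i j. if i \<le> j then t (j - i) i else s (i - j) j)"

text \<open>Since \<open>t c (Suc i) \<le> t (Suc c) i\<close>, lowering the entry index costs one
  step along the chain, which is zero from \<open>N\<close> on. This keeps glued arrays inside the
  box.\<close>

lemma is_chain_eq_0:
  assumes "is_chain N t" "N \<le> c + i" shows "t c i = 0"
  using assms(2)
proof (induction i arbitrary: c)
  case 0
  then show ?case using assms(1) by (simp add: is_chain_def)
next
  case (Suc i)
  then have "t (Suc c) i = 0" by simp
  then show ?case using assms(1) by (metis interlaces_def is_chain_def le_zero_eq)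
qed

lemma bij_betw_glue:
  "bij_betw glue {p. is_chain N (fst p) \<and> is_chain N (snd p) \<and> fst p 0 = snd p 0} {\<pi>. box_partition N \<pi>}"
proof (rule bij_betw_byWitness[where f' = "\<lambda>\<pi>. (\<lambda>c i. \<pi> i (i + c), \<lambda>c j. \<pi> (j + c) j)"], goal_cases)
  case 1
  then show ?case by (auto simp: glue_def fun_eq_iff)
next
  case 2
  then show ?case by (auto simp: glue_def fun_eq_iff)
next
  case 3
  have "box_partition N (glue (t, s))"
    if t: "is_chain N t" and s: "is_chain N s" and eq: "t 0 = s 0" for t s
  proof -
    have I: "t (Suc c) i \<le> t c i" "t c (Suc i) \<le> t (Suc c) i" "s (Suc c) i \<le> s c i" "s c (Suc i) \<le> s (Suc c) i"
      for c i using t s by (auto simp: is_chain_def interlaces_def)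
    have "glue (t, s) i (Suc j) \<le> glue (t, s) i j" for i j
    proof -
      \<comment> \<open>The case \<open>i = Suc j\<close> is the step from below onto the main
        diagonal, where \<open>t 0 = s 0\<close> is used.\<close>
      consider "i \<le> j" | "i = Suc j" | d where "i = Suc (Suc (j + d))"
        by (metis Suc_leI less_iff_Suc_add not_less_eq nat_less_le not_le)
      then show ?thesis
      proof cases
        case 1
        then show ?thesis using I(1)[of "j - i" i] by (simp add: glue_def Suc_diff_le)
      next
        case 2
        then show ?thesis using I(4)[of 0 j] by (simp add: glue_def eq)
      next
        case 3
        then show ?thesis using I(4)[of "Suc d" j] by (simp add: glue_def)
      qed
    qed
    moreover have "glue (t, s) (Suc i) j \<le> glue (t, s) i j" for i j
    proof -
      consider "j < i" | "i = j" | d where "j = Suc (i + d)"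
        by (metis less_iff_Suc_add linorder_less_linear)
      then show ?thesis
      proof cases
        case 1
        then show ?thesis using I(3)[of "i - j" j] by (simp add: glue_def Suc_diff_le)
      next
        case 2
        then show ?thesis using I(3)[of 0 j] by (simp add: glue_def eq)
      next
        case 3
        then show ?thesis using I(2)[of d i] by (simp add: glue_def)
      qed
    qed
    moreover have "glue (t, s) i j = 0" if "N \<le> i \<or> N \<le> j" for i j
      using that is_chain_eq_0[OF t, of "j - i" i] is_chain_eq_0[OF s, of "i - j" j] by (auto simp: glue_def)
    ultimately show ?thesis by (simp add: box_partition_def)
  qed
  then show ?case by auto
next
  case 4
  then show ?case by (auto simp: box_partition_def is_chain_def interlaces_def fun_eq_iff)
qed

lemma sum_above:
  fixes f :: "nat \<Rightarrow> nat"
  assumes "\<And>j. N \<le> j \<Longrightarrow> f j = 0"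
  shows "(\<Sum>j<N. if i < j then f j else 0) = (\<Sum>c<N. f (i + Suc c))"
proof -
  have "(\<Sum>j<N. if i < j then f j else 0) = (\<Sum>j\<in>{Suc i..<Suc i + N}. f j)"
    using assms by (intro sum.mono_neutral_cong) (auto simp: not_less)
  also have "\<dots> = (\<Sum>c<N. f (i + Suc c))"
    using sum.shift_bounds_nat_ivl[of f 0 "Suc i" N]
    by (simp add: add_ac atLeast0LessThan)
  finally show ?thesis .
qed

lemma box_size_glue:
  assumes t: "is_chain N t" and s: "is_chain N s" and eq: "t 0 = s 0"
  shows "box_size N (glue (t, s)) = psize (t 0) + tail_size N t + tail_size N s"
proof -
  let ?p = "glue (t, s)"
  have psz: "psize (u c) = (\<Sum>i<N. u c i)" if "is_chain N u" for u c
    by (rule psize_eq) (use is_chain_eq_0[OF that] in auto)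
  have z: "?p i j = 0" if "N \<le> i \<or> N \<le> j" for i j
    using bij_betw_glue[of N] t s eq that
    by (fastforce simp: box_partition_def dest: bij_betwE)
  have "box_size N ?p = (\<Sum>i<N. \<Sum>j<N. (if j = i then ?p i j else 0) +
      ((if i < j then ?p i j else 0) + (if j < i then ?p i j else 0)))"
    unfolding box_size_def by (intro sum.cong) auto
  also have "\<dots> = (\<Sum>i<N. ?p i i) + (\<Sum>i<N. \<Sum>j<N. if i < j then ?p i j else 0)
      + (\<Sum>j<N. \<Sum>i<N. if j < i then ?p i j else 0)"
    by (subst (2) sum.swap) (simp add: sum.distrib)
  also have "\<dots> = (\<Sum>i<N. ?p i i) + (\<Sum>i<N. \<Sum>c<N. ?p i (i + Suc c)) + (\<Sum>j<N. \<Sum>c<N. ?p (j + Suc c) j)"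
    by (simp add: sum_above z)
  also have "\<dots> = (\<Sum>i<N. t 0 i) + (\<Sum>c<N. \<Sum>i<N. t (Suc c) i) + (\<Sum>c<N. \<Sum>j<N. s (Suc c) j)"
    by (subst sum.swap, subst (2) sum.swap) (simp add: glue_def)
  finally show ?thesis using t s by (simp add: tail_size_def psz)
qed

lemma macmahon_box:
  "(\<Sum>\<^sup>+ \<pi>. of_bool (box_partition N \<pi>) * q ^ box_size N \<pi>) = (\<Prod>j<N. \<Prod>i<N. geo (q ^ Suc (i + j)))"
proof -
  let ?C = "\<lambda>p. is_chain N (fst p) \<and> is_chain N (snd p) \<and> fst p 0 = snd p 0"
  have "(\<Sum>\<^sup>+ \<pi>. of_bool (box_partition N \<pi>) * q ^ box_size N \<pi>) = (\<Sum>\<^sup>+ p. of_bool (?C p) * q ^ box_size N (glue p))"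
    by (rule nsum_bij[OF bij_betw_glue, symmetric])
  also have "\<dots> = (\<Sum>\<^sup>+ p. of_bool (?C p) * (q ^ psize (fst p 0) * (q ^ tail_size N (fst p) * q ^ tail_size N (snd p))))"
    by (intro nn_integral_cong) (auto simp: box_size_glue power_add mult_ac)
  \<comment> \<open>Summing over the common main diagonal \<open>l\<close> makes the two halves
    independent, so that the sum over pairs factors by \<open>nsum_times\<close>.\<close>
  also have "\<dots> = (\<Sum>\<^sup>+ p. \<Sum>\<^sup>+ l. of_bool (l = fst p 0) * (q ^ psize l *
     (of_bool (is_chain N (fst p) \<and> fst p 0 = l) * q ^ tail_size N (fst p) *
     (of_bool (is_chain N (snd p) \<and> snd p 0 = l) * q ^ tail_size N (snd p)))))"
    by (simp only: nsum_single) (auto intro!: nn_integral_cong)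
  also have "\<dots> = (\<Sum>\<^sup>+ p. \<Sum>\<^sup>+ l. q ^ psize l *
     (of_bool (is_chain N (fst p) \<and> fst p 0 = l) * q ^ tail_size N (fst p) *
     (of_bool (is_chain N (snd p) \<and> snd p 0 = l) * q ^ tail_size N (snd p))))"
    by (intro nn_integral_cong) auto
  also have "\<dots> = (\<Sum>\<^sup>+ l. q ^ psize l * (chain_sum q N l * chain_sum q N l))"
    by (subst nsum_swap) (simp add: chain_sum_chains nsum_times nn_integral_cmult)
  also have "\<dots> = (\<Prod>j<N. \<Prod>i<N. geo (q ^ Suc (i + j)))"
    by (simp add: box_sum)
  finally show ?thesis .
qed

section \<open>Plane partition numbers as box counts\<close>

lemma plane_partition_of_box:
  assumes "box_partition N \<pi>" shows "plane_partition_of (box_size N \<pi>) \<pi>"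
proof -
  have *: "\<pi> i j \<noteq> 0 \<Longrightarrow> i < N \<and> j < N" for i j
    using assms unfolding box_partition_def by (meson not_le)
  then have sub: "{(i, j). \<pi> i j \<noteq> 0} \<subseteq> {..<N} \<times> {..<N}" by auto
  have "(\<Sum>(i, j) | \<pi> i j \<noteq> 0. \<pi> i j) = (\<Sum>(i, j)\<in>{..<N} \<times> {..<N}. \<pi> i j)"
    using sub by (intro sum.mono_neutral_left) auto
  moreover have "finite {(i, j). \<pi> i j \<noteq> 0}" using sub by (rule finite_subset) auto
  ultimately show ?thesis using assms
    by (auto simp: plane_partition_of_def box_size_def box_partition_def sum.cartesian_product)
qed

text \<open>By monotonicity a non-zero entry at \<open>(i, j)\<close> forces \<open>Suc i\<close>
  non-zero entries in its column and \<open>Suc j\<close> in its row, while there are at most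
  \<open>n\<close> in all.\<close>

lemma box_partition_of_plane_partition:
  assumes "plane_partition_of n \<pi>" "n \<le> N" shows "box_partition N \<pi>"
proof -
  let ?S = "{(i, j). \<pi> i j \<noteq> 0}"
  have row: "\<And>i j. \<pi> i (Suc j) \<le> \<pi> i j" and col: "\<And>i j. \<pi> (Suc i) j \<le> \<pi> i j"
    and fin: "finite ?S" and sum: "sum (case_prod \<pi>) ?S = n"
    using assms by (auto simp: plane_partition_of_def)
  have "card ?S \<le> n"
    using sum_mono[of ?S "\<lambda>_. 1" "case_prod \<pi>"] sum by (auto simp: Suc_le_eq)
  then have card: "card A \<le> n" if "A \<subseteq> ?S" for A
    using card_mono[OF fin that] by simp
  have "\<pi> i j = 0" if "N \<le> i \<or> N \<le> j" for i j
  proof (rule ccontr)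
    assume nz: "\<pi> i j \<noteq> 0"
    have "\<pi> i j \<le> \<pi> i' j" if "i' \<le> i" for i'
      using that by (rule lift_Suc_antimono_le[of "\<lambda>i. \<pi> i j", OF col])
    with nz have "Suc i \<le> n" using card[of "(\<lambda>i. (i, j)) ` {..i}"]
      by (fastforce simp: card_image inj_on_def)
    moreover have "\<pi> i j \<le> \<pi> i j'" if "j' \<le> j" for j'
      using that by (rule lift_Suc_antimono_le[of "\<lambda>j. \<pi> i j", OF row])
    with nz have "Suc j \<le> n" using card[of "(\<lambda>j. (i, j)) ` {..j}"]
      by (fastforce simp: card_image inj_on_def)
    ultimately show False using that assms(2) by linarith
  qed
  then show ?thesis using row col by (simp add: box_partition_def)
qed

definition box_count :: "nat \<Rightarrow> nat \<Rightarrow> nat" where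
  "box_count N n = card {\<pi>. box_partition N \<pi> \<and> box_size N \<pi> = n}"

text \<open>Coefficients up to \<open>N\<close> do not see the box, so a finite product carries all
  the information needed about \<open>pp n\<close>.\<close>

lemma box_count_eq_pp:
  assumes "n \<le> N" shows "box_count N n = pp n"
proof -
  have "plane_partition_of m \<pi> \<Longrightarrow> plane_partition_of n \<pi> \<Longrightarrow> m = n" for m n \<pi>
    by (simp add: plane_partition_of_def)
  then have "plane_partition_of n \<pi> \<longleftrightarrow> box_partition N \<pi> \<and> box_size N \<pi> = n" for \<pi>
    using plane_partition_of_box[of N \<pi>] box_partition_of_plane_partition[of n \<pi> N] assms by blast
  then show ?thesis by (simp add: box_count_def pp_def)
qed

lemma box_count_sum:
  "(\<Sum>\<^sup>+ n. of_nat (box_count N n) * q ^ n) = (\<Prod>j<N. \<Prod>i<N. geo (q ^ Suc (i + j)))"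
proof -
  have fin: "finite {\<pi>. box_partition N \<pi> \<and> box_size N \<pi> = n}" for n
    by (rule finite_subset[OF _ finite_plane_partitions[of n]]) (use plane_partition_of_box in auto)
  have "(\<Sum>\<^sup>+ n. of_nat (box_count N n) * q ^ n)
     = (\<Sum>\<^sup>+ n. \<Sum>\<^sup>+ \<pi>. of_bool (box_partition N \<pi> \<and> box_size N \<pi> = n) * q ^ n)"
    unfolding nsum_of_bool by (simp add: nn_integral_count_space_finite fin box_count_def mult.commute)
  also have "\<dots> = (\<Sum>\<^sup>+ \<pi>. \<Sum>\<^sup>+ n. of_bool (n = box_size N \<pi>) * (of_bool (box_partition N \<pi>) * q ^ n))"
    by (subst nsum_swap) (auto intro!: nn_integral_cong)
  also have "\<dots> = (\<Sum>\<^sup>+ \<pi>. of_bool (box_partition N \<pi>) * q ^ box_size N \<pi>)"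
    by (simp only: nsum_single)
  finally show ?thesis by (simp only: macmahon_box)
qed


section \<open>The divisor sum recurrence\<close>

lemma geo_ennreal:
  assumes "0 \<le> x" "x < 1" shows "geo (ennreal x) = ennreal (1 / (1 - x))"
proof -
  have "geo (ennreal x) = (\<Sum>n. ennreal (x ^ n))"
    using assms by (simp add: geo_def nn_integral_count_space_nat ennreal_power)
  also have "\<dots> = ennreal (1 / (1 - x))"
    using assms by (intro suminf_ennreal_eq geometric_sums) auto
  finally show ?thesis .
qed

text \<open>For \<open>x < 1\<close> the product is finite, and a series of non-negative terms with
  finite extended sum is summable.\<close>

lemma box_count_sums:
  assumes "0 \<le> x" "x < (1::real)"
  shows "(\<lambda>n. real (box_count N n) * x ^ n) sums (\<Prod>j<N. \<Prod>i<N. 1 / (1 - x ^ Suc (i + j)))"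
    (is "?f sums ?R")
proof -
  have pos: "0 < 1 - x ^ Suc n" for n using assms power_Suc_less_one[of x n]
    by (cases "x = 0") auto
  then have nn: "0 \<le> 1 / (1 - x ^ Suc n)" for n by (simp add: less_imp_le)
  have "(\<Sum>n. ennreal (?f n)) = (\<Sum>\<^sup>+ n. of_nat (box_count N n) * ennreal x ^ n)"
    using assms by (simp add: nn_integral_count_space_nat ennreal_power ennreal_mult ennreal_of_nat_eq_real_of_nat)
  also have "\<dots> = (\<Prod>j<N. \<Prod>i<N. geo (ennreal (x ^ Suc (i + j))))"
    using assms by (subst box_count_sum) (simp only: ennreal_power)
  also have "\<dots> = (\<Prod>j<N. \<Prod>i<N. ennreal (1 / (1 - x ^ Suc (i + j))))"
    using assms pos by (intro prod.cong refl geo_ennreal) auto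
  also have "\<dots> = ennreal ?R"
    using nn by (simp only: prod_ennreal prod_nonneg)
  finally have *: "(\<Sum>n. ennreal (?f n)) = ennreal ?R" .
  have f: "0 \<le> ?f n" for n using assms by simp
  have sm: "summable ?f" by (rule summable_suminf_not_top[OF f]) (simp add: *)
  have R: "0 \<le> ?R" using nn by (intro prod_nonneg) auto
  have "suminf ?f = ?R"
    using * suminf_ennreal2[OF f sm] suminf_nonneg[OF sm f] R by simp
  with sm show ?thesis by (auto simp: sums_iff)
qed

text \<open>If \<open>F\<close> were non-zero, dividing out its lowest power of \<open>fps_X\<close>
  would leave a series vanishing on \<open>(0, r)\<close>, hence by continuity at 0, where its value
  is the lowest non-zero coefficient of \<open>F\<close>.\<close>

lemma fps_eq_0_if_eval_fps_eq_0:
  fixes F :: "real fps"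
  assumes "r > 0" "ereal r \<le> fps_conv_radius F" "\<And>x. 0 < x \<Longrightarrow> x < r \<Longrightarrow> eval_fps F x = 0"
  shows "F = 0"
proof (rule ccontr)
  assume nz: "F \<noteq> 0"
  define U where "U = fps_shift (subdegree F) F"
  have rad: "0 < fps_conv_radius U" 
    using assms(1,2) by (simp add: U_def) (metis ereal_less(2) less_le_trans)
  have 0: "eval_fps U x = 0" if "0 < x" "x < r" for x
  proof -
    have "ereal (norm x) < fps_conv_radius F" using that assms(2)
      by (auto intro: less_le_trans[of _ "ereal r"])
    then show ?thesis using that assms(3)[of x] by (simp add: U_def eval_fps_shift)
  qed
  have "(eval_fps U \<longlongrightarrow> eval_fps U 0) (at_right 0)"
    using continuous_eval_fps[of 0 U "{0<..}"] rad by (simp add: continuous_within zero_ereal_def)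
  moreover have "(eval_fps U \<longlongrightarrow> 0) (at_right 0)"
    using 0 assms(1) by (intro tendsto_eventually) (auto simp: eventually_at_right intro!: exI[of _ r])
  ultimately have "eval_fps U 0 = 0" by (rule tendsto_unique[rotated]) simp
  then show False using nz by (simp add: U_def eval_fps_at_0)
qed

lemma box_count_fps:
  "Abs_fps (\<lambda>n. real (box_count N n)) * (\<Prod>(j, i)\<in>{..<N} \<times> {..<N}. 1 - fps_X ^ Suc (i + j)) = 1"
    (is "?G * ?P = 1")
proof -
  define p :: "real poly" where "p = (\<Prod>(j, i)\<in>{..<N} \<times> {..<N}. 1 - monom 1 (Suc (i + j)))"
  have P: "?P = fps_of_poly p"
    by (simp add: p_def fps_of_poly_prod fps_of_poly_diff fps_of_poly_monom case_prod_unfold)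
  \<comment> \<open>Any radius strictly between 0 and 1 would serve here.\<close>
  have G: "ereal (1/2) \<le> fps_conv_radius ?G"
    using conv_radius_geI[OF sums_summable[OF box_count_sums[of "1/2" N]]]
    by (simp add: fps_conv_radius_def)
  have GP: "ereal (1/2) \<le> fps_conv_radius (?G * fps_of_poly p)"
    using fps_conv_radius_mult[of ?G "fps_of_poly p"] G by simp
  have "?G * fps_of_poly p - 1 = 0"
  proof (rule fps_eq_0_if_eval_fps_eq_0[of "1/2"])
    show "ereal (1/2) \<le> fps_conv_radius (?G * fps_of_poly p - 1)"
      using fps_conv_radius_diff[of "?G * fps_of_poly p" 1] GP by simp
    fix x :: real assume x: "0 < x" "x < 1/2"
    then have less: "ereal (norm x) < ereal (1/2)" by simp
    have nz: "1 - x ^ Suc n \<noteq> 0" for n using x power_Suc_less_one[of x n] by simp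
    have "eval_fps ?G x = (\<Prod>j<N. \<Prod>i<N. 1 / (1 - x ^ Suc (i + j)))"
      using box_count_sums[of x N] x by (simp add: eval_fps_def sums_iff)
    moreover have "poly p x = (\<Prod>j<N. \<Prod>i<N. 1 - x ^ Suc (i + j))"
      by (simp only: p_def poly_prod prod.cartesian_product) (simp add: case_prod_unfold poly_monom)
    ultimately have "eval_fps ?G x * poly p x = 1"
      using nz by (simp only: prod.distrib[symmetric]) simp
    then show "eval_fps (?G * fps_of_poly p - 1) x = 0"
      using less_le_trans[OF less G] less_le_trans[OF less GP]
      by (simp add: eval_fps_diff eval_fps_mult)
  qed simp
  then show ?thesis unfolding P by (simp only: right_minus_eq)
qed

text \<open>The logarithmic derivative of \<open>1 / (1 - X ^ m)\<close>, multiplied by \<open>X\<close>.\<close>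

definition lambert :: "nat \<Rightarrow> 'a::comm_ring_1 fps" where
  "lambert m = Abs_fps (\<lambda>n. if n > 0 \<and> m dvd n then of_nat m else 0)"

text \<open>The coefficients of \<open>lambert m\<close> at \<open>n\<close> and
  \<open>n - m\<close> cancel for \<open>n > m\<close>. At \<open>n = m\<close> they do not, since
  the constant coefficient is 0.\<close>

lemma lambert_mult:
  assumes "m > 0" shows "(1 - fps_X ^ m) * lambert m = of_nat m * fps_X ^ m"
proof (rule fps_ext)
  fix n
  have "m dvd n - m \<longleftrightarrow> m dvd n" if "m \<le> n" using that by (simp add: dvd_minus_self)
  then show "fps_nth ((1 - fps_X ^ m) * lambert m) n = fps_nth (of_nat m * fps_X ^ m :: 'a fps) n"
    using assms
    by (auto simp: left_diff_distrib fps_X_power_mult_nth lambert_def fps_of_nat[symmetric] dest: dvd_imp_le)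
qed

text \<open>Stated without quotients, so that the product rule gives it one factor at a
  time.\<close>

lemma log_deriv_prod:
  fixes m :: "'b \<Rightarrow> nat"
  assumes "finite A" "\<And>x. x \<in> A \<Longrightarrow> m x > 0"
  shows "fps_X * fps_deriv (\<Prod>x\<in>A. 1 - fps_X ^ m x) =
         - ((\<Prod>x\<in>A. 1 - fps_X ^ m x) * (\<Sum>x\<in>A. lambert (m x) :: 'a::comm_ring_1 fps))"
  using assms
proof (induction A)
  case (insert a A)
  have "fps_X * fps_X ^ (m a - 1) = (fps_X ^ m a :: 'a fps)"
    using insert by (simp add: power_eq_if)
  then have "fps_X * fps_deriv (1 - fps_X ^ m a) = - (of_nat (m a) * fps_X ^ m a :: 'a fps)"
    by (simp add: fps_deriv_power fps_of_nat[symmetric] mult_ac)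
  also have "\<dots> = - ((1 - fps_X ^ m a) * lambert (m a))"
    using insert by (simp add: lambert_mult)
  finally have *: "fps_X * fps_deriv (1 - fps_X ^ m a) = - ((1 - fps_X ^ m a) * (lambert (m a) :: 'a fps))" .
  let ?P = "\<Prod>x\<in>A. 1 - (fps_X ^ m x :: 'a fps)"
  have "fps_X * fps_deriv ((1 - fps_X ^ m a) * ?P) =
      (fps_X * fps_deriv (1 - fps_X ^ m a)) * ?P + (1 - fps_X ^ m a) * (fps_X * fps_deriv ?P)"
    by (simp only: fps_deriv_mult) (simp add: algebra_simps)
  also have "\<dots> = - ((1 - fps_X ^ m a) * ?P * (lambert (m a) + (\<Sum>x\<in>A. lambert (m x))))"
    using insert by (subst *, subst insert.IH) (auto simp: algebra_simps)
  finally show ?case using insert by simp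
qed simp

definition sigma2 :: "nat \<Rightarrow> nat" where
  "sigma2 k = (\<Sum>d | d dvd k. d\<^sup>2)"

text \<open>The antidiagonal \<open>i + j + 1 = d\<close> has \<open>d\<close> cells in the box when
  \<open>d \<le> N\<close>. This multiplicity times the coefficient \<open>d\<close> of
  \<open>lambert d\<close> produces the squares in \<open>sigma2\<close>.\<close>

lemma sum_box_diagonals:
  fixes h :: "nat \<Rightarrow> nat"
  assumes "\<And>d. N < d \<Longrightarrow> h d = 0"
  shows "(\<Sum>j<N. \<Sum>i<N. h (Suc (i + j))) = (\<Sum>d\<le>N. d * h d)"
proof -
  \<comment> \<open>The added summand \<open>i = N\<close> has index beyond \<open>N\<close>, where
    \<open>h\<close> vanishes; it fits the range to \<open>sum_above\<close> at
    \<open>Suc N\<close>.\<close>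
  have "(\<Sum>j<N. \<Sum>i<N. h (Suc (i + j))) = (\<Sum>j<N. \<Sum>i<Suc N. h (j + Suc i))"
    using assms by (simp add: add_ac)
  also have "\<dots> = (\<Sum>j<N. \<Sum>d<Suc N. if j < d then h d else 0)"
    using assms by (subst sum_above) auto
  also have "\<dots> = (\<Sum>d<Suc N. \<Sum>j<N. if j < d then h d else 0)"
    by (rule sum.swap)
  also have "\<dots> = (\<Sum>d<Suc N. d * h d)"
  proof (rule sum.cong)
    fix d assume "d \<in> {..<Suc N}"
    then have "{j \<in> {..<N}. j < d} = {..<d}" by auto
    then show "(\<Sum>j<N. if j < d then h d else 0) = d * h d"
      by (simp add: sum.inter_filter[symmetric])
  qed simp
  finally show ?thesis by (simp add: lessThan_Suc_atMost)
qed

text \<open>Differentiating \<open>G * P = 1\<close> gives \<open>X * G' = G * L\<close>, whose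
  coefficient at \<open>n\<close> is the claim. In a box of side \<open>n\<close>, the coefficients
  of \<open>G\<close> up to \<open>n\<close> and those of \<open>L\<close> from 1 to
  \<open>n\<close> already have their final values.\<close>

theorem pp_recurrence: "n * pp n = (\<Sum>k=1..n. sigma2 k * pp (n - k))"
proof -
  let ?A = "{..<n} \<times> {..<n}"
  let ?m = "\<lambda>x. Suc (snd x + fst x)"
  define G where "G = Abs_fps (\<lambda>k. real (box_count n k))"
  define P :: "real fps" where "P = (\<Prod>x\<in>?A. 1 - fps_X ^ ?m x)"
  define L :: "real fps" where "L = (\<Sum>x\<in>?A. lambert (?m x))"
  have GP: "G * P = 1" using box_count_fps[of n] by (simp only: G_def P_def case_prod_unfold)
  have XP: "fps_X * fps_deriv P = - (P * L)"
    unfolding P_def L_def by (rule log_deriv_prod) auto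
  have "0 = fps_X * fps_deriv (G * P)" by (simp add: GP)
  also have "\<dots> = P * (fps_X * fps_deriv G) + G * (fps_X * fps_deriv P)"
    by (simp add: algebra_simps)
  also have "\<dots> = P * (fps_X * fps_deriv G) - L"
    using GP by (simp add: XP mult.assoc[symmetric])
  finally have "P * (fps_X * fps_deriv G) = L" by simp
  then have "G * P * (fps_X * fps_deriv G) = G * L" by (simp add: mult_ac)
  then have eq: "fps_X * fps_deriv G = G * L" by (simp add: GP)
  have Gn: "fps_nth G k = real (pp k)" if "k \<le> n" for k
    using that by (simp add: G_def box_count_eq_pp)
  have Lk: "fps_nth L k = real (sigma2 k)" if "k \<in> {1..n}" for k
  proof -
    let ?h = "\<lambda>d. if d dvd k then d else 0"
    have fin: "finite {d. d dvd k}" using that by simp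
    have "fps_nth L k = real (\<Sum>x\<in>?A. ?h (?m x))"
      using that by (simp add: L_def fps_sum_nth lambert_def)
        (auto intro!: sum.cong)
    also have "(\<Sum>x\<in>?A. ?h (?m x)) = (\<Sum>j<n. \<Sum>i<n. ?h (Suc (i + j)))"
      by (simp only: sum.cartesian_product case_prod_unfold)
    also have "\<dots> = (\<Sum>d\<le>n. d * ?h d)"
      using that by (intro sum_box_diagonals) (auto dest: dvd_imp_le)
    also have "\<dots> = sigma2 k" unfolding sigma2_def
      using that fin by (intro sum.mono_neutral_cong_right) (auto simp: power2_eq_square dest: dvd_imp_le)
    finally show ?thesis .
  qed
  have L0: "fps_nth L 0 = 0" by (simp add: L_def fps_sum_nth lambert_def)
  have "real (n * pp n) = fps_nth (fps_X * fps_deriv G) n"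
    using Gn[of n] by (cases n) (auto simp: algebra_simps)
  also have "\<dots> = fps_nth (L * G) n" by (simp add: eq mult.commute)
  also have "\<dots> = (\<Sum>k=0..n. fps_nth L k * fps_nth G (n - k))" by (simp add: fps_mult_nth)
  also have "\<dots> = (\<Sum>k=1..n. fps_nth L k * fps_nth G (n - k))"
    by (simp add: sum.atLeast_Suc_atMost L0)
  also have "\<dots> = real (\<Sum>k=1..n. sigma2 k * pp (n - k))"
    using Lk Gn by simp
  finally show ?thesis using of_nat_eq_iff by blast
qed


section \<open>Small values\<close>

text \<open>The length 67 comes from \<open>pp_cubic_bound\<close>, whose halving argument starts at
  \<open>68 = 2 * 34\<close>; \<open>pp_mult_small\<close> needs indices up to 66.\<close>

definition sigma_list :: "int list" where
  "sigma_list = map (\<lambda>k. sum_list (map (\<lambda>d. if k mod d = 0 then d * d else 0) [1..k])) [1..67]"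

text \<open>
  The list of values is kept in reverse, so that the convolution with the divisor sums is a plain
  componentwise product, truncated to the shorter list by \<^const>\<open>map2\<close>.
\<close>

definition pp_rev :: "int list \<Rightarrow> int list" where
  "pp_rev ms = foldl (\<lambda>ps m. sum_list (map2 (*) sigma_list ps) div m # ps) [1] ms"

definition pp_table :: "int list" where
  "pp_table = [
    1, 1, 3, 6, 13, 24, 48, 86, 160, 282, 500, 859, 1479, 2485, 4167, 6879, 11297, 18334, 29601,
    47330, 75278, 118794, 186475, 290783, 451194, 696033, 1068745, 1632658, 2483234, 3759612,
    5668963, 8512309, 12733429, 18974973, 28175955, 41691046, 61484961, 90379784, 132441995,
    193487501, 281846923, 409383981, 593001267, 856667495, 1234363833, 1774079109, 2543535902,
    3637993036, 5191304973, 7391026522, 10499640707, 14883573114, 21053676445, 29720561230,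
    41871334614, 58874385349, 82623976486, 115737404664, 161825846160, 225863047430, 314689799781,
    437699333376, 607771804065, 842541287719, 1166117605448, 1611415838202, 2223312543970,
    3062906627106]"

lemma int_range: "[1..int n] = map (\<lambda>i. int (Suc i)) [0..<n]"
  by (induction n) (simp_all add: upto_rec2 add.commute)

lemma int_sigma2:
  assumes "k > 0"
  shows "int (sigma2 k) = sum_list (map (\<lambda>d. if int k mod d = 0 then d * d else 0) [1..int k])"
proof -
  have "sum_list (map (\<lambda>d. if int k mod d = 0 then d * d else 0) [1..int k])
      = (\<Sum>i\<in>{0..<k}. if int k mod int (Suc i) = 0 then int (Suc i) * int (Suc i) else 0)"
    unfolding int_range by (simp only: map_map o_def sum_set_upt_conv_sum_list_nat[symmetric] set_upt)
  also have "\<dots> = (\<Sum>i\<in>Suc ` {0..<k}. if i dvd k then int i * int i else 0)"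
    unfolding sum.reindex[OF inj_Suc] o_def by (intro sum.cong) (simp_all only: dvd_eq_mod_eq_0 zmod_int[symmetric] of_nat_eq_0_iff)
  also have "\<dots> = (\<Sum>d | d dvd k. int d * int d)"
    using assms by (intro sum.mono_neutral_cong_right) (auto simp: less_Suc_eq_le intro: dvd_imp_le dvd_pos_nat)
  finally show ?thesis by (simp add: sigma2_def power2_eq_square)
qed

lemma sigma_list: "sigma_list = map (\<lambda>i. int (sigma2 (Suc i))) [0..<67]"
proof -
  have "[1..67] = map (\<lambda>i. int (Suc i)) [0..<67]" using int_range[of 67] by simp
  then show ?thesis by (simp add: sigma_list_def int_sigma2 o_def del: of_nat_Suc)
qed

text \<open>The bound on \<open>n\<close> ensures that \<open>map2\<close> truncates
  \<open>sigma_list\<close> and never the list of values.\<close>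

lemma pp_rev_eq:
  "n \<le> 67 \<Longrightarrow> pp_rev [1..int n] = map (\<lambda>i. int (pp (n - i))) [0..<Suc n]"
proof (induction n)
  case 0
  then show ?case by (simp add: pp_rev_def pp_0)
next
  case (Suc n)
  let ?ps = "map (\<lambda>i. int (pp (n - i))) [0..<Suc n]"
  have "sum_list (map2 (*) sigma_list ?ps) = (\<Sum>i = 0..<Suc n. int (sigma2 (Suc i)) * int (pp (n - i)))"
    using Suc.prems unfolding sum_list_sum_nth
    by (intro sum.cong) (simp_all add: sigma_list del: upt_Suc)
  also have "\<dots> = int (Suc n * pp (Suc n))"
    by (simp only: pp_recurrence[of "Suc n"] One_nat_def sum.atLeast1_atMost_eq) (simp add: atLeast0LessThan)
  finally have "sum_list (map2 (*) sigma_list ?ps) div int (Suc n) = int (pp (Suc n))"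
    by (simp only: of_nat_mult) simp
  moreover have "[1..int (Suc n)] = [1..int n] @ [int (Suc n)]"
    by (simp add: upto_rec2)
  ultimately have "pp_rev [1..int (Suc n)] = int (pp (Suc n)) # ?ps"
    using Suc by (simp add: pp_rev_def del: upt_Suc of_nat_Suc)
  also have "\<dots> = map (\<lambda>i. int (pp (Suc n - i))) (0 # map Suc [0..<Suc n])"
    by (simp del: upt_Suc)
  also have "0 # map Suc [0..<Suc n] = [0..<Suc (Suc n)]"
    by (simp only: map_Suc_upt upt_conv_Cons[of 0 "Suc (Suc n)"] zero_less_Suc)
  finally show ?case .
qed

lemma rev_map_upt_nth: "i < n \<Longrightarrow> rev (map f [0..<n]) ! i = f (n - Suc i)"
  by (simp add: rev_nth)

lemma pp_table:
  assumes "i \<le> 67" shows "int (pp i) = pp_table ! i"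
proof -
  have "pp_rev [1..67] = rev pp_table" by code_simp
  then have "rev pp_table = map (\<lambda>i. int (pp (67 - i))) [0..<68]"
    using pp_rev_eq[of 67] by simp
  then have eq: "pp_table = rev (map (\<lambda>i. int (pp (67 - i))) [0..<68])"
    by (metis rev_rev_ident)
  have "i < 68" using assms by simp
  then have "pp_table ! i = int (pp (67 - (68 - Suc i)))"
    unfolding eq by (rule rev_map_upt_nth)
  then show ?thesis using assms by simp
qed

lemma list_all_uptD: "list_all P [m..<n] \<Longrightarrow> m \<le> i \<Longrightarrow> i < n \<Longrightarrow> P i"
  by (simp add: list_all_iff)

lemma pp_mult_small:
  assumes "b \<le> a" "a < 34" "2 \<le> b" "12 \<le> a + b"
  shows "pp (a + b) < pp a * pp b"
proof -
  have *: "list_all (\<lambda>a. list_all (\<lambda>b. 12 \<le> a + b \<longrightarrow> pp_table ! (a + b) < pp_table ! a * pp_table ! b)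
      [2..<Suc a]) [2..<34]"
    by code_simp
  have "pp_table ! (a + b) < pp_table ! a * pp_table ! b"
    using list_all_uptD[OF list_all_uptD[OF *], of a b] assms by simp
  then have "int (pp (a + b)) < int (pp a) * int (pp b)"
    using assms by (simp add: pp_table)
  then show ?thesis by (simp only: of_nat_mult[symmetric] of_nat_less_iff)
qed

text \<open>The factor 3 is attained at \<open>a = b = 1\<close>. The first bound controls the
  exceptional summands in \<open>pp_mult_large\<close>, the second excludes equality for sums below
  12.\<close>

lemma pp_mult_tiny:
  assumes "a + b \<le> 11"
  shows "pp (a + b) \<le> 3 * pp a * pp b" and "2 \<le> a \<Longrightarrow> 2 \<le> b \<Longrightarrow> pp a * pp b \<noteq> pp (a + b)"
proof -
  have *: "list_all (\<lambda>a. list_all (\<lambda>b. pp_table ! (a + b) \<le> 3 * pp_table ! a * pp_table ! b \<and>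
      (2 \<le> a \<longrightarrow> 2 \<le> b \<longrightarrow> pp_table ! a * pp_table ! b \<noteq> pp_table ! (a + b))) [0..<12 - a]) [0..<12]"
    by code_simp
  have "pp_table ! (a + b) \<le> 3 * pp_table ! a * pp_table ! b \<and>
      (2 \<le> a \<longrightarrow> 2 \<le> b \<longrightarrow> pp_table ! a * pp_table ! b \<noteq> pp_table ! (a + b))"
    using list_all_uptD[OF list_all_uptD[OF *], of a b] assms by simp
  then have **: "int (pp (a + b)) \<le> 3 * int (pp a) * int (pp b) \<and>
      (2 \<le> a \<longrightarrow> 2 \<le> b \<longrightarrow> int (pp a) * int (pp b) \<noteq> int (pp (a + b)))"
    using assms by (simp add: pp_table)
  have "int (pp (a + b)) \<le> int (3 * pp a * pp b)" using ** by simp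
  then show "pp (a + b) \<le> 3 * pp a * pp b" by (simp only: of_nat_le_iff)
  show "pp a * pp b \<noteq> pp (a + b)" if "2 \<le> a" "2 \<le> b"
    using ** that by (metis of_nat_mult)
qed


section \<open>Products of plane partition numbers\<close>

lemma sigma2_ge: "k > 0 \<Longrightarrow> k\<^sup>2 \<le> sigma2 k"
  unfolding sigma2_def by (rule member_le_sum) auto

lemma sigma2_pos: "0 < k \<Longrightarrow> 0 < sigma2 k"
  using sigma2_ge[of k] by (metis gr0I le_zero_eq zero_less_power)

lemma sigma2_le: "k > 0 \<Longrightarrow> sigma2 k \<le> k ^ 3"
proof -
  assume k: "k > 0"
  then have "sigma2 k \<le> of_nat (card {d. d dvd k}) * k\<^sup>2"
    unfolding sigma2_def by (intro sum_bounded_above) (auto dest: dvd_imp_le)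
  also have "card {d. d dvd k} \<le> card {1..k}"
    using k by (intro card_mono) (auto dest: dvd_imp_le dvd_pos_nat simp: Suc_le_eq)
  finally show ?thesis by (simp add: power2_eq_square power3_eq_cube)
qed

text \<open>
  The constant is one more than the \<open>624 + 8\<close> needed in \<open>pp_mult_large\<close>, and 34 is the first index
  from which the bound holds. Beyond 67 the single summand \<open>k = n div 2\<close> of the recurrence suffices.
\<close>

lemma pp_cubic_bound: "34 \<le> n \<Longrightarrow> 633 * n ^ 3 \<le> pp n"
proof (induction n rule: less_induct)
  case (less n)
  show ?case
  proof (cases "n < 68")
    case True
    have *: "list_all (\<lambda>n. 633 * int n ^ 3 \<le> pp_table ! n) [34..<68]" by code_simp
    have "633 * int n ^ 3 \<le> pp_table ! n"
      using list_all_uptD[OF *] True less.prems by simp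
    then have "int (633 * n ^ 3) \<le> int (pp n)" using True by (simp add: pp_table)
    then show ?thesis by (simp only: of_nat_le_iff)
  next
    case False
    define h where "h = n div 2"
    have h: "34 \<le> h" "h \<le> n" "n \<le> 2 * (n - h)" "n \<le> 2 * h + 1" "34 \<le> n - h" "n - h < n"
      using False by (auto simp: h_def)
    \<comment> \<open>The aim is \<open>n ^ 4 \<le> h\<^sup>2 * (n - h) ^ 3\<close>. Since
      \<open>n \<le> 2 * (n - h)\<close>, it suffices that
      \<open>8 * n \<le> h\<^sup>2\<close>.\<close>
    have "8 * n \<le> 34 * h" using h by linarith
    also have "34 * h \<le> h\<^sup>2" using h by (simp add: power2_eq_square)
    finally have 1: "8 * n \<le> h\<^sup>2" .
    have 2: "n ^ 3 \<le> 8 * (n - h) ^ 3"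
      using power_mono[OF h(3), of 3] by (simp add: power_mult_distrib)
    have "8 * (n * (633 * n ^ 3)) = 633 * ((8 * n) * n ^ 3)" by simp
    also have "\<dots> \<le> 633 * (h\<^sup>2 * (8 * (n - h) ^ 3))"
      using 1 2 by (intro mult_le_mono) auto
    also have "\<dots> = 8 * (h\<^sup>2 * (633 * (n - h) ^ 3))" by simp
    finally have "n * (633 * n ^ 3) \<le> h\<^sup>2 * (633 * (n - h) ^ 3)" by simp
    also have "\<dots> \<le> sigma2 h * pp (n - h)"
      using h by (intro mult_le_mono sigma2_ge less.IH) auto
    also have "\<dots> \<le> (\<Sum>k=1..n. sigma2 k * pp (n - k))"
      using h by (intro member_le_sum) auto
    also have "\<dots> = n * pp n" by (rule pp_recurrence[symmetric])
    finally show ?thesis using False by simp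
  qed
qed

lemma pp_1: "pp 1 = 1"
  using pp_recurrence[of 1] by (simp add: sigma2_def pp_0)

lemma pp_Suc_recurrence: "Suc n * pp (Suc n) = (\<Sum>k=1..n. sigma2 k * pp (Suc n - k)) + sigma2 (Suc n)"
  by (subst pp_recurrence) (simp add: pp_0)

text \<open>The recurrences for \<open>Suc n\<close> and \<open>n\<close> are compared term by term;
  the one extra term \<open>sigma2 (Suc n)\<close> is absorbed by \<open>pp_cubic_bound\<close>.
  This serves the summand \<open>j = 1\<close> in \<open>pp_mult_large\<close>.\<close>

lemma pp_Suc_le: "pp (Suc n) \<le> 3 * pp n"
proof (induction n rule: less_induct)
  case (less n)
  show ?case
  proof (cases "n < 34")
    case True
    have *: "list_all (\<lambda>n. pp_table ! Suc n \<le> 3 * pp_table ! n) [0..<34]" by code_simp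
    have "pp_table ! Suc n \<le> 3 * pp_table ! n"
      using list_all_uptD[OF *] True by simp
    then have "int (pp (Suc n)) \<le> int (3 * pp n)" using True by (simp add: pp_table)
    then show ?thesis by (simp only: of_nat_le_iff)
  next
    case False
    have "sigma2 k * pp (Suc n - k) \<le> 3 * (sigma2 k * pp (n - k))" if "k \<in> {1..n}" for k
      using less.IH[of "n - k"] that by (simp add: Suc_diff_le)
    then have "(\<Sum>k=1..n. sigma2 k * pp (Suc n - k)) \<le> 3 * (n * pp n)"
      unfolding pp_recurrence sum_distrib_left by (rule sum_mono)
    moreover have "sigma2 (Suc n) \<le> 3 * pp n"
    proof -
      have "sigma2 (Suc n) \<le> (Suc n) ^ 3" by (rule sigma2_le) simp
      also have "\<dots> \<le> (2 * n) ^ 3" using False by (intro power_mono) auto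
      also have "\<dots> \<le> 633 * n ^ 3" by (simp add: power_mult_distrib)
      also have "\<dots> \<le> pp n" using False by (intro pp_cubic_bound) simp
      finally show ?thesis by simp
    qed
    ultimately have "Suc n * pp (Suc n) \<le> Suc n * (3 * pp n)"
      unfolding pp_Suc_recurrence by simp
    then show ?thesis by (simp only: Suc_mult_le_cancel1)
  qed
qed

text \<open>With weights 1 instead of \<open>sigma2 k\<close>, the difference of the recurrences
  telescopes to \<open>pp n - 1\<close>. Larger weights only increase it by monotonicity below
  \<open>n\<close>, and the extra \<open>sigma2 (Suc n) \<ge> 2\<close> makes the inequality
  strict.\<close>

lemma pp_less_Suc: "0 < n \<Longrightarrow> pp n < pp (Suc n)"
proof (induction n rule: less_induct)
  case (less n)
  have mono: "pp m \<le> pp (Suc m)" if "m < n" for m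
    using less.IH[of m] that pp_0 pp_1 by (cases "m = 0") auto
  have "n * pp n + (\<Sum>k=1..n. pp (Suc n - k)) \<le> (\<Sum>k=1..n. sigma2 k * pp (Suc n - k)) + (\<Sum>k=1..n. pp (n - k))"
    unfolding pp_recurrence sum.distrib[symmetric]
  proof (rule sum_mono)
    fix k assume k: "k \<in> {1..n}"
    obtain s where s: "sigma2 k = Suc s"
      using k sigma2_pos[of k] by (cases "sigma2 k") auto
    have "pp (n - k) \<le> pp (Suc n - k)" using mono[of "n - k"] k by (simp add: Suc_diff_le)
    then show "sigma2 k * pp (n - k) + pp (Suc n - k) \<le> sigma2 k * pp (Suc n - k) + pp (n - k)"
      by (simp add: s)
  qed
  moreover have "(\<Sum>k=1..n. pp (Suc n - k)) + 1 = pp n + (\<Sum>k=1..n. pp (n - k))"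
  proof -
    have "(\<Sum>k=1..n. pp (Suc n - k)) + 1 = (\<Sum>k=0..n. pp (n - k))"
      using sum.shift_bounds_cl_Suc_ivl[of "\<lambda>k. pp (Suc n - k)" 0 n] by (simp add: pp_0)
    then show ?thesis by (simp add: sum.atLeast_Suc_atMost)
  qed
  moreover have "2 \<le> sigma2 (Suc n)"
    using sigma2_ge[of "Suc n"] less.prems by (cases n) (auto simp: power2_eq_square)
  ultimately have "Suc n * pp n < Suc n * pp (Suc n)"
    unfolding pp_Suc_recurrence by simp
  then show ?case by (simp only: Suc_mult_less_cancel1)
qed

text \<open>
  In the recurrence for \<open>pp (a + b)\<close>, the summands with \<open>k \<le> a\<close> are compared with those for \<open>pp a\<close>,
  the others with those for \<open>pp b\<close>. The pairs \<open>(a - k, b)\<close> that violate the inequality all have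
  \<open>a - k < 10\<close>, and their total contribution is a cubic polynomial in \<open>a\<close> times \<open>pp b\<close>.
\<close>

lemma pp_mult_large:
  assumes "34 \<le> a" "2 \<le> b" "b \<le> a"
    and IH: "\<And>j. 2 \<le> j \<Longrightarrow> j < a \<Longrightarrow> 12 \<le> j + b \<Longrightarrow> pp (j + b) < pp j * pp b"
  shows "pp (a + b) < pp a * pp b"
proof -
  \<comment> \<open>An exception with \<open>2 \<le> j\<close> has \<open>j + b \<le> 11\<close>, so
    \<open>2 \<le> b\<close> gives \<open>j < 10\<close>. The excess is at most \<open>3 - 1\<close>
    times the product.\<close>
  have near: "pp (j + b) \<le> pp j * pp b + (if j < 10 then 2 * pp j * pp b else 0)" if "j < a" for j
  proof -
    consider "j = 0" | "j = 1" | "2 \<le> j" "12 \<le> j + b" | "2 \<le> j" "j + b \<le> 11" by linarith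
    then show ?thesis
    proof cases
      case 1
      then show ?thesis by (simp add: pp_0)
    next
      case 2
      then show ?thesis using pp_Suc_le[of b] pp_1 by simp
    next
      case 3
      then show ?thesis using IH[of j] that by simp
    next
      case 4
      then show ?thesis using pp_mult_tiny(1)[of j b] assms by (simp add: ac_simps)
    qed
  qed
  have "(\<Sum>k=1..a. sigma2 k * pp (a + b - k))
      \<le> (\<Sum>k=1..a. sigma2 k * pp (a - k) * pp b + a ^ 3 * (if a - k < 10 then 2 * pp (a - k) * pp b else 0))"
  proof (rule sum_mono)
    fix k assume k: "k \<in> {1..a}"
    then have "sigma2 k \<le> k ^ 3" by (intro sigma2_le) simp
    also have "k ^ 3 \<le> a ^ 3" using k by (intro power_mono) auto
    finally have "sigma2 k \<le> a ^ 3" .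
    let ?e = "if a - k < 10 then 2 * pp (a - k) * pp b else 0"
    have "sigma2 k * pp (a + b - k) \<le> sigma2 k * (pp (a - k) * pp b + ?e)"
      using near[of "a - k"] k by (intro mult_le_mono2) simp
    also have "\<dots> = sigma2 k * pp (a - k) * pp b + sigma2 k * ?e"
      by (simp only: add_mult_distrib2 mult.assoc)
    also have "\<dots> \<le> sigma2 k * pp (a - k) * pp b + a ^ 3 * ?e"
      using \<open>sigma2 k \<le> a ^ 3\<close> by (intro add_left_mono mult_le_mono1)
    finally show "sigma2 k * pp (a + b - k) \<le> sigma2 k * pp (a - k) * pp b + a ^ 3 * ?e" .
  qed
  also have "\<dots> = a * pp a * pp b + a ^ 3 * (\<Sum>k=1..a. if a - k < 10 then 2 * pp (a - k) * pp b else 0)"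
    by (simp add: sum.distrib pp_recurrence sum_distrib_right sum_distrib_left)
  also have "(\<Sum>k=1..a. if a - k < 10 then 2 * pp (a - k) * pp b else 0)
      = (\<Sum>j<a. if j < 10 then 2 * pp j * pp b else 0)"
    by (rule sum.reindex_bij_witness[of _ "\<lambda>j. a - j" "\<lambda>k. a - k"]) auto
  also have "\<dots> = (\<Sum>j<10. 2 * pp j * pp b)"
    using assms(1) by (intro sum.mono_neutral_cong_right) auto
  also have "\<dots> = 2 * pp b * (\<Sum>j<10. pp j)" by (simp add: sum_distrib_left mult_ac)
  also have "(\<Sum>j<10. pp j) = 624"
  proof -
    have "int (\<Sum>j<10. pp j) = (\<Sum>j<10. pp_table ! j)" by (simp add: pp_table)
    also have "\<dots> = 624" by code_simp
    finally show ?thesis by linarith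
  qed
  finally have first: "(\<Sum>k=1..a. sigma2 k * pp (a + b - k)) \<le> a * pp a * pp b + 1248 * a ^ 3 * pp b"
    by simp
  have "(\<Sum>k=1..b. sigma2 (a + k) * pp (b - k)) \<le> (\<Sum>k=1..b. 8 * a ^ 3 * (sigma2 k * pp (b - k)))"
  proof (rule sum_mono)
    fix k assume k: "k \<in> {1..b}"
    have "sigma2 (a + k) \<le> (a + k) ^ 3" using k by (intro sigma2_le) auto
    also have "\<dots> \<le> (2 * a) ^ 3" using k assms by (intro power_mono) auto
    \<comment> \<open>Inserting \<open>sigma2 k \<ge> 1\<close> turns the sum into the recurrence
      for \<open>b\<close>.\<close>
    also have "\<dots> \<le> 8 * a ^ 3 * sigma2 k"
      using sigma2_pos[of k] k by (simp add: power_mult_distrib Suc_le_eq)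
    finally show "sigma2 (a + k) * pp (b - k) \<le> 8 * a ^ 3 * (sigma2 k * pp (b - k))"
      by (simp add: mult.assoc[symmetric])
  qed
  also have "\<dots> = 8 * a ^ 3 * (b * pp b)"
    by (simp add: sum_distrib_left pp_recurrence)
  finally have second: "(\<Sum>k=1..b. sigma2 (a + k) * pp (b - k)) \<le> 8 * a ^ 3 * (b * pp b)" .
  have "0 < a ^ 3" using assms(1) by simp
  then have strict: "632 * a ^ 3 < pp a"
    using pp_cubic_bound[OF assms(1)] by linarith
  have pos: "0 < pp b"
    using pp_less_Suc[of "b - 1"] assms by simp
  have "(a + b) * pp (a + b) = (\<Sum>k=1..a. sigma2 k * pp (a + b - k)) + (\<Sum>k=a + 1..a + b. sigma2 k * pp (a + b - k))"
    unfolding pp_recurrence by (rule sum.ub_add_nat) simp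
  also have "(\<Sum>k=a + 1..a + b. sigma2 k * pp (a + b - k)) = (\<Sum>k=1..b. sigma2 (a + k) * pp (b - k))"
    using sum.shift_bounds_cl_nat_ivl[of "\<lambda>k. sigma2 k * pp (a + b - k)" 1 a b] by (simp add: add_ac)
  also have "(\<Sum>k=1..a. sigma2 k * pp (a + b - k)) + \<dots> \<le> a * pp a * pp b + 1248 * a ^ 3 * pp b + 8 * a ^ 3 * (b * pp b)"
    using first second by simp
  \<comment> \<open>\<open>2 \<le> b\<close> turns 1248 into \<open>624 * b\<close>, so both errors
    carry a factor \<open>b\<close> and fit into \<open>b * pp b * pp a\<close>.\<close>
  also have "\<dots> \<le> a * pp a * pp b + 624 * b * a ^ 3 * pp b + 8 * a ^ 3 * (b * pp b)"
    using assms(2) by simp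
  also have "\<dots> = a * pp a * pp b + b * pp b * (632 * a ^ 3)" by (simp add: algebra_simps)
  also have "\<dots> < a * pp a * pp b + b * pp b * pp a"
    using strict assms(2) pos by simp
  also have "\<dots> = (a + b) * (pp a * pp b)" by (simp add: algebra_simps)
  finally show ?thesis by (simp only: mult_less_cancel1)
qed

lemma pp_mult:
  assumes "2 \<le> a" "2 \<le> b" "12 \<le> a + b"
  shows "pp (a + b) < pp a * pp b"
proof -
  have claim: "pp (a + b) < pp a * pp b" if "2 \<le> b" "b \<le> a" "12 \<le> a + b" for a b
    using that
  proof (induction "a + b" arbitrary: a b rule: less_induct)
    case less
    show ?case
    proof (cases "a < 34")
      case True
      with less.prems show ?thesis by (intro pp_mult_small) auto
    next
      case False
      show ?thesis
      proof (rule pp_mult_large)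
        fix j assume "2 \<le> j" "j < a" "12 \<le> j + b"
        then show "pp (j + b) < pp j * pp b"
          \<comment> \<open>Here \<open>j\<close> may be smaller than \<open>b\<close>; then the
            induction hypothesis applies to the swapped pair.\<close>
          using less.hyps[of j b] less.hyps[of b j] less.prems
          by (cases "b \<le> j") (auto simp: add.commute mult.commute)
      qed (use False less.prems in auto)
    qed
  qed
  show ?thesis using assms claim[of b a] claim[of a b] by (cases "b \<le> a") (simp_all add: ac_simps)
qed

theorem theorem1p1:
  fixes a b :: nat
  assumes "a > 0" and "b > 0"
  shows "(a \<ge> 2 \<and> b \<ge> 2 \<and> a + b \<ge> 12 \<longrightarrow> pp a * pp b > pp (a + b)) \<and>
         pp a * pp b \<noteq> pp (a + b)"
proof -
  consider "a = 1" | "b = 1" | "2 \<le> a" "2 \<le> b" using assms by linarith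
  then have "pp a * pp b \<noteq> pp (a + b)"
  proof cases
    case 1
    then show ?thesis using pp_less_Suc[of b] assms pp_1 by simp
  next
    case 2
    then show ?thesis using pp_less_Suc[of a] assms pp_1 by simp
  next
    case 3
    then show ?thesis using pp_mult[of a b] pp_mult_tiny(2)[of a b] by (cases "12 \<le> a + b") auto
  qed
  then show ?thesis using pp_mult by simp
qed

end
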